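(* Let $\Omega$ be a countably infinite set and let $G$ be a group of permutations of $\Omega$ with locally finite algebraic closure. Suppose that the centre $Z(G)$ of $G$ is non-trivial. Then the semigroup Zariski topology on $\overline{G}$ is not Hausdorff. Likewise, the semigroup Zariski topology on $G$ is not Hausdorff.
   Context: $\Omega^\Omega$ is the monoid of all maps $\Omega\to\Omega$ under composition, equipped with the topology of pointwise convergence $\tau_{pw}$ (the product topology, $\Omega$ being discrete); $\overline{G}$ denotes the closure of $G$ in $\Omega^\Omega$ with respect to $\tau_{pw}$, which is a monoid. For a finite $B\subseteq\Omega$, $G_B$ denotes the pointwise stabiliser of $B$ in $G$, and $\mathrm{acl}(B)$ is the set of points of $\Omega$ whose orbit under $G_B$ is finite. $G$ has locally finite algebraic closure if $\mathrm{acl}(B)$ is finite for every finite $B\subseteq\Omega$. For a monoid $S$, the semigroup Zariski topology on $S$ is the topology generated by the solution sets (in one variable $s$) of all inequalities of the form $\lambda_n s\lambda_{n-1}s\cdots\lambda_1 s\lambda_0\neq \eta_m s\eta_{m-1}s\cdots \eta_1 s\eta_0$ with $n,m\ge 0$ and $\lambda_i,\eta_j\in S$. *)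

theory Defs
  imports "HOL-Analysis.Analysis" "HOL-Algebra.Bij"
begin

text \<open>As in \<^const>\<open>BijGroup\<close>, maps on the set \<open>\<Omega>\<close> are represented by their extensional
  versions, so that equality of maps is HOL equality.\<close>

definition map_monoid :: "'a set \<Rightarrow> ('a \<Rightarrow> 'a) monoid" where
  "map_monoid \<Omega> = \<lparr>carrier = \<Omega> \<rightarrow>\<^sub>E \<Omega>, mult = compose \<Omega>, one = (\<lambda>x\<in>\<Omega>. x)\<rparr>"

definition pointwise_topology :: "'a set \<Rightarrow> ('a \<Rightarrow> 'a) topology" where
  "pointwise_topology \<Omega> = product_topology (\<lambda>_. discrete_topology \<Omega>) \<Omega>"

definition closure_monoid :: "'a set \<Rightarrow> ('a \<Rightarrow> 'a) set \<Rightarrow> ('a \<Rightarrow> 'a) monoid" where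
  "closure_monoid \<Omega> G = (map_monoid \<Omega>)\<lparr>carrier := pointwise_topology \<Omega> closure_of G\<rparr>"

definition pointwise_stabiliser :: "('a \<Rightarrow> 'a) set \<Rightarrow> 'a set \<Rightarrow> ('a \<Rightarrow> 'a) set" where
  "pointwise_stabiliser G B = {g \<in> G. \<forall>b\<in>B. g b = b}"

definition acl :: "'a set \<Rightarrow> ('a \<Rightarrow> 'a) set \<Rightarrow> 'a set \<Rightarrow> 'a set" where
  "acl \<Omega> G B = {x \<in> \<Omega>. finite ((\<lambda>g. g x) ` pointwise_stabiliser G B)}"

definition locally_finite_acl :: "'a set \<Rightarrow> ('a \<Rightarrow> 'a) set \<Rightarrow> bool" where
  "locally_finite_acl \<Omega> G \<longleftrightarrow> (\<forall>B. finite B \<and> B \<subseteq> \<Omega> \<longrightarrow> finite (acl \<Omega> G B))"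

definition centre :: "('a, 'b) monoid_scheme \<Rightarrow> 'a set" where
  "centre M = {z \<in> carrier M. \<forall>g\<in>carrier M. z \<otimes>\<^bsub>M\<^esub> g = g \<otimes>\<^bsub>M\<^esub> z}"

text \<open>\<open>word_eval M c n s\<close> is the product \<open>c\<^sub>n s c\<^sub>n\<^sub>-\<^sub>1 s \<dots> c\<^sub>1 s c\<^sub>0\<close> in \<open>M\<close>, with \<open>n\<close> occurrences
  of \<open>s\<close>.\<close>

primrec word_eval :: "('a, 'b) monoid_scheme \<Rightarrow> (nat \<Rightarrow> 'a) \<Rightarrow> nat \<Rightarrow> 'a \<Rightarrow> 'a" where
  "word_eval M c 0 s = c 0"
| "word_eval M c (Suc n) s = c (Suc n) \<otimes>\<^bsub>M\<^esub> (s \<otimes>\<^bsub>M\<^esub> word_eval M c n s)"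

text \<open>The carrier is itself a solution set (of an inequality \<open>\<lambda>\<^sub>0 \<noteq> \<eta>\<^sub>0\<close>) unless \<open>M\<close> is trivial. It
  is added to the subbasis explicitly because \<^const>\<open>generate_topology_on\<close> does not include the
  empty intersection.\<close>

definition zariski_topology :: "('a, 'b) monoid_scheme \<Rightarrow> 'a topology" where
  "zariski_topology M = topology_generated_by
     (insert (carrier M)
       {{s \<in> carrier M. word_eval M l n s \<noteq> word_eval M e m s} | l n e m.
          (\<forall>i\<le>n. l i \<in> carrier M) \<and> (\<forall>j\<le>m. e j \<in> carrier M)})"

end

theory Submission
  imports Defs
begin

text \<open>A central \<open>z \<noteq> 1\<close> cannot be separated from \<open>1\<close>. If both sides of an inequality contain \<open>s\<close>
  equally often, then its values at \<open>z\<close> and at \<open>1\<close> differ by a common power of \<open>z\<close>, so that it holds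
  at \<open>1\<close> whenever it holds at \<open>z\<close>, and then on a pointwise neighbourhood of \<open>1\<close>. If the numbers of
  occurrences differ, its solution set is pointwise dense in \<open>G\<close>, because local finiteness of
  algebraic closure allows \<open>s\<close> to be chosen generically. Hence every Zariski neighbourhood of \<open>z\<close> is
  pointwise dense near \<open>1\<close>, while every Zariski neighbourhood of \<open>1\<close> is also a pointwise one.\<close>

section \<open>Words at points and pointwise approximation\<close>

primrec word_path :: "(nat \<Rightarrow> 'a \<Rightarrow> 'a) \<Rightarrow> nat \<Rightarrow> ('a \<Rightarrow> 'a) \<Rightarrow> 'a \<Rightarrow> 'a" where
  "word_path c 0 s a = c 0 a"
| "word_path c (Suc n) s a = c (Suc n) (s (word_path c n s a))"

definition agree_on :: "'a set \<Rightarrow> ('a \<Rightarrow> 'b) \<Rightarrow> ('a \<Rightarrow> 'b) \<Rightarrow> bool" where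
  "agree_on B f g \<longleftrightarrow> (\<forall>x\<in>B. f x = g x)"

text \<open>A combinatorial description of the pointwise closure of \<open>G\<close>: a basic
  neighbourhood in a power of a discrete space prescribes finitely many values.\<close>

definition approximable :: "'a set \<Rightarrow> ('a \<Rightarrow> 'a) set \<Rightarrow> ('a \<Rightarrow> 'a) set" where
  "approximable \<Omega> G = {f \<in> \<Omega> \<rightarrow>\<^sub>E \<Omega>. \<forall>A. finite A \<and> A \<subseteq> \<Omega> \<longrightarrow> (\<exists>g\<in>G. agree_on A g f)}"

text \<open>Prescribing the values of \<open>f\<close> on a finite set gives an open box around
  \<open>f\<close>, which must meet \<open>G\<close>.\<close>

lemma closure_of_subset_approximable:
  "pointwise_topology \<Omega> closure_of G \<subseteq> approximable \<Omega> G"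
proof
  fix f assume f: "f \<in> pointwise_topology \<Omega> closure_of G"
  then have fE: "f \<in> \<Omega> \<rightarrow>\<^sub>E \<Omega>"
    by (auto simp: in_closure_of pointwise_topology_def)
  have "\<exists>g\<in>G. agree_on A g f" if A: "finite A" "A \<subseteq> \<Omega>" for A
  proof -
    let ?X = "\<lambda>x. if x \<in> A then {f x} else \<Omega>"
    have "finite {x. ?X x \<noteq> \<Omega>}"
      by (rule finite_subset[OF _ A(1)]) auto
    moreover have "?X x \<subseteq> \<Omega>" for x
      using fE A(2) by auto
    ultimately have "openin (pointwise_topology \<Omega>) (PiE \<Omega> ?X)"
      unfolding pointwise_topology_def
      by (intro product_topology_basis[of "\<lambda>_. discrete_topology \<Omega>" ?X \<Omega>])
        (simp_all only: topspace_discrete_topology openin_discrete_topology)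
    moreover have "f \<in> PiE \<Omega> ?X"
      using fE by (auto simp: PiE_iff)
    ultimately have "\<exists>g. g \<in> G \<and> g \<in> PiE \<Omega> ?X"
      using f[unfolded in_closure_of, THEN conjunct2, rule_format, of "PiE \<Omega> ?X"] by simp
    then obtain g where g: "g \<in> G" "g \<in> PiE \<Omega> ?X" by (elim exE conjE)
    have "g x = f x" if "x \<in> A" for x
      using PiE_mem[OF g(2), of x] A(2) that by auto
    with g(1) show ?thesis by (auto simp: agree_on_def)
  qed
  with fE show "f \<in> approximable \<Omega> G"
    by (auto simp: approximable_def)
qed

section \<open>Permutation groups and their pointwise limits\<close>

locale lf_acl_perm_group =
  fixes \<Omega> :: "'a set" and G :: "('a \<Rightarrow> 'a) set"
  assumes infinite_points: "infinite \<Omega>"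
    and subgroup: "subgroup G (BijGroup \<Omega>)"
    and lf_acl: "locally_finite_acl \<Omega> G"
begin

abbreviation "stab \<equiv> pointwise_stabiliser G"
abbreviation "C \<equiv> approximable \<Omega> G"

definition idm where "idm = (\<lambda>x\<in>\<Omega>. x)"

lemma group_Bij: "s \<in> G \<Longrightarrow> s \<in> Bij \<Omega>"
  using subgroup.subset[OF subgroup] by (auto simp: BijGroup_def)

lemma group_inj: "s \<in> G \<Longrightarrow> inj_on s \<Omega>"
  and group_maps: "s \<in> G \<Longrightarrow> x \<in> \<Omega> \<Longrightarrow> s x \<in> \<Omega>"
  and group_PiE: "s \<in> G \<Longrightarrow> s \<in> \<Omega> \<rightarrow>\<^sub>E \<Omega>"
  using group_Bij by (auto simp: Bij_def bij_betw_def PiE_def)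

lemma id_in_group: "idm \<in> G"
  using subgroup.one_closed[OF subgroup] by (simp add: BijGroup_def idm_def)

lemma compose_in_group: "s \<in> G \<Longrightarrow> t \<in> G \<Longrightarrow> compose \<Omega> s t \<in> G"
  using subgroup.m_closed[OF subgroup, of s t] group_Bij by (simp add: BijGroup_def)

lemma group_inverse:
  assumes "s \<in> G"
  obtains t where "t \<in> G" "\<And>x. x \<in> \<Omega> \<Longrightarrow> t (s x) = x"
proof
  let ?t = "inv\<^bsub>BijGroup \<Omega>\<^esub> s"
  show "?t \<in> G"
    using subgroup.m_inv_closed[OF subgroup assms] .
  show "?t (s x) = x" if "x \<in> \<Omega>" for x
    using that assms
    by (simp add: inv_BijGroup group_Bij group_maps group_inj inv_into_f_f)
qed

lemma group_subset_approximable: "G \<subseteq> C"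
  unfolding approximable_def agree_on_def using group_PiE by blast

lemma approximable_maps: "f \<in> C \<Longrightarrow> x \<in> \<Omega> \<Longrightarrow> f x \<in> \<Omega>"
  by (auto simp: approximable_def)

text \<open>Injectivity is a condition on pairs of points, and some element of \<open>G\<close>
  agrees with \<open>f\<close> on any given pair.\<close>

lemma approximable_inj:
  assumes "f \<in> C" shows "inj_on f \<Omega>"
proof (rule inj_onI)
  fix x y assume xy: "x \<in> \<Omega>" "y \<in> \<Omega>" "f x = f y"
  then obtain g where "g \<in> G" "agree_on {x, y} g f"
    using assms unfolding approximable_def by (auto dest: spec[of _ "{x, y}"])
  with xy show "x = y"
    using group_inj[of g] by (auto simp: agree_on_def inj_on_def)
qed

text \<open>This lets coefficients be handled like permutations: avoiding finitely many values after
  applying \<open>f\<close> means avoiding finitely many points before it.\<close>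

lemma approximable_preimage_finite:
  "f \<in> C \<Longrightarrow> finite F \<Longrightarrow> finite {x \<in> \<Omega>. f x \<in> F}"
  using finite_vimage_IntI[OF _ approximable_inj, of F f]
  by (simp add: vimage_def Int_def conj_commute)

section \<open>Algebraic closure and generic points\<close>

lemma acl_finite: "finite D \<Longrightarrow> D \<subseteq> \<Omega> \<Longrightarrow> finite (acl \<Omega> G D)"
  using lf_acl by (simp add: locally_finite_acl_def)

lemma orbit_infinite:
  "x \<in> \<Omega> \<Longrightarrow> x \<notin> acl \<Omega> G D \<Longrightarrow> infinite ((\<lambda>g. g x) ` stab D)"
  by (simp add: acl_def)

lemma compose_in_stab: "D \<subseteq> \<Omega> \<Longrightarrow> s \<in> stab D \<Longrightarrow> t \<in> stab D \<Longrightarrow> compose \<Omega> s t \<in> stab D"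
  unfolding pointwise_stabiliser_def by (auto simp: compose_in_group compose_eq subset_iff)

text \<open>The case of two points of P. M. Neumann's separation lemma.\<close>

lemma move_two_points_off:
  assumes D: "D \<subseteq> \<Omega>" and p: "p \<in> \<Omega>" "p \<notin> acl \<Omega> G D" and q: "q \<in> \<Omega>" "q \<notin> acl \<Omega> G D"
    and F: "finite F"
  shows "\<exists>h\<in>stab D. h p \<notin> F \<and> h q \<notin> F"
proof (cases "p \<in> acl \<Omega> G (insert q D)")
  case False
  \<comment> \<open>First \<open>h\<close> places \<open>q\<close>. Then \<open>k\<close>, which
    fixes \<open>q\<close> and \<open>D\<close>, moves \<open>p\<close> out of the preimage of
    \<open>F\<close> under \<open>h\<close>, so that applying \<open>k\<close> before
    \<open>h\<close> serves both points.\<close>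
  obtain h where h: "h \<in> stab D" "h q \<notin> F"
    using orbit_infinite[OF q] F by (metis finite_subset image_subsetI)
  then have hG: "h \<in> G"
    by (simp add: pointwise_stabiliser_def)
  have "finite {x \<in> \<Omega>. h x \<in> F}"
    using hG F group_subset_approximable approximable_preimage_finite by blast
  then obtain k where k: "k \<in> stab (insert q D)" "k p \<notin> {x \<in> \<Omega>. h x \<in> F}"
    using orbit_infinite[OF p(1) False] by (metis (no_types, lifting) finite_subset image_subsetI)
  have kD: "k \<in> stab D" "k \<in> G" "k q = q"
    using k by (auto simp: pointwise_stabiliser_def)
  have "compose \<Omega> h k \<in> stab D"
    using compose_in_stab[OF D] h kD by blast
  moreover have "compose \<Omega> h k p \<notin> F" "compose \<Omega> h k q \<notin> F"
    using k h kD p q group_maps by (auto simp: compose_eq)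
  ultimately show ?thesis by blast
next
  case True
  show ?thesis
  proof (rule ccontr)
    assume neg: "\<not> ?thesis"
    \<comment> \<open>If no \<open>h\<close> works, every \<open>h\<close> that moves
      \<open>p\<close> off \<open>F\<close> sends \<open>q\<close> into the finite set
      \<open>F\<close>. Hence infinitely many images of \<open>p\<close> go with one and the same
      image of \<open>q\<close>.\<close>
    let ?Y = "(\<lambda>g. g p) ` stab D - F"
    have Y: "infinite ?Y"
      using orbit_infinite[OF p] F by simp
    have "\<forall>y\<in>?Y. \<exists>h. h \<in> stab D \<and> h p = y \<and> h q \<in> F"
      using neg by blast
    then obtain h where h: "\<And>y. y \<in> ?Y \<Longrightarrow> h y \<in> stab D \<and> h y p = y \<and> h y q \<in> F"
      by metis
    have "finite ((\<lambda>y. h y q) ` ?Y)"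
      using h F by (metis (no_types, lifting) finite_subset image_subsetI)
    from pigeonhole_infinite[OF Y this] obtain y0 where y0: "y0 \<in> ?Y"
      and inf: "infinite {y \<in> ?Y. h y q = h y0 q}" by blast
    have h0: "h y0 \<in> G"
      using h[OF y0] by (simp add: pointwise_stabiliser_def)
    obtain t where t: "t \<in> G" "\<And>x. x \<in> \<Omega> \<Longrightarrow> t (h y0 x) = x"
      using group_inverse[OF h0] by blast
    let ?Z = "{y \<in> ?Y. h y q = h y0 q}"
    \<comment> \<open>Following \<open>h y\<close> by the inverse \<open>t\<close> of
      \<open>h y0\<close> fixes \<open>q\<close> and \<open>D\<close> and sends \<open>p\<close> to
      \<open>t y\<close>. As \<open>t\<close> is injective, these are infinitely many points,
      although \<open>p\<close> is algebraic over \<open>insert q D\<close>.\<close>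
    have "t ` ?Z \<subseteq> (\<lambda>g. g p) ` stab (insert q D)"
    proof
      fix w assume "w \<in> t ` ?Z"
      then obtain y where y: "y \<in> ?Z" "w = t y" by blast
      have hy: "h y \<in> stab D" "h y p = y" "h y q = h y0 q"
        using y h by auto
      have tD: "t x = x" if "x \<in> D" for x
        using t(2)[of x] h[OF y0] that D by (auto simp: pointwise_stabiliser_def)
      have "compose \<Omega> t (h y) \<in> stab (insert q D)"
        using hy t tD D q unfolding pointwise_stabiliser_def
        by (auto simp: compose_in_group compose_eq subset_iff)
      moreover have "compose \<Omega> t (h y) p = w"
        using hy y p by (simp add: compose_eq)
      ultimately show "w \<in> (\<lambda>g. g p) ` stab (insert q D)" by blast
    qed
    moreover have "finite ((\<lambda>g. g p) ` stab (insert q D))"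
      using True by (simp add: acl_def)
    ultimately have "finite (t ` ?Z)"
      using finite_subset by blast
    moreover have "?Z \<subseteq> \<Omega>"
      using p group_maps by (auto simp: pointwise_stabiliser_def)
    then have "inj_on t ?Z"
      using group_inj[OF t(1)] inj_on_subset by blast
    ultimately show False
      using inf finite_imageD by blast
  qed
qed

text \<open>Precomposing \<open>s\<close> with an element of the stabiliser of \<open>D\<close>
  keeps the values on \<open>D\<close>. The requirements at \<open>p\<close> and \<open>q\<close>
  only forbid a finite set \<open>E\<close> of images, by injectivity of \<open>f\<close>,
  \<open>g\<close> and \<open>s\<close>, and two points can be moved off \<open>E\<close>
  together.\<close>

lemma extend_generically:
  assumes s: "s \<in> G" and D: "D \<subseteq> \<Omega>" and p: "p \<in> \<Omega>" "p \<notin> acl \<Omega> G D" and q: "q \<in> \<Omega>" "q \<notin> acl \<Omega> G D"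
    and fg: "f \<in> C" "g \<in> C" and F: "finite F"
  shows "\<exists>s'\<in>G. agree_on D s' s \<and> f (s' p) \<notin> F \<and> g (s' q) \<notin> F"
proof -
  have sC: "s \<in> C" using s group_subset_approximable by blast
  define E where "E = {x \<in> \<Omega>. s x \<in> {y \<in> \<Omega>. f y \<in> F \<or> g y \<in> F}}"
  have "finite {y \<in> \<Omega>. f y \<in> F \<or> g y \<in> F}"
    using approximable_preimage_finite[OF fg(1) F] approximable_preimage_finite[OF fg(2) F]
    by (rule rev_finite_subset[OF finite_UnI]) auto
  then have "finite E"
    unfolding E_def by (rule approximable_preimage_finite[OF sC])
  then obtain h where h: "h \<in> stab D" "h p \<notin> E" "h q \<notin> E"
    using move_two_points_off[OF D p q] by blast
  then have hG: "h \<in> G" and hD: "\<And>x. x \<in> D \<Longrightarrow> h x = x"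
    by (auto simp: pointwise_stabiliser_def)
  show ?thesis
  proof (intro bexI conjI)
    show "compose \<Omega> s h \<in> G" using compose_in_group s hG by blast
    show "agree_on D (compose \<Omega> s h) s"
      using hD D by (auto simp: agree_on_def compose_eq)
    show "f (compose \<Omega> s h p) \<notin> F" "g (compose \<Omega> s h q) \<notin> F"
      using h hG p q s group_maps by (auto simp: E_def compose_eq)
  qed
qed

section \<open>Trajectories of points under words\<close>

lemma word_path_in:
  assumes "\<And>i. i \<le> n \<Longrightarrow> c i \<in> C" "s \<in> G" "a \<in> \<Omega>"
  shows "word_path c n s a \<in> \<Omega>"
  using assms by (induction n) (auto simp: approximable_maps group_maps)

text \<open>The witness \<open>B\<close> consists of the points to which \<open>s\<close> is applied
  along the trajectory of \<open>a\<close>. This is continuity of words in \<open>s\<close> for the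
  pointwise topology.\<close>

lemma word_path_finite_support:
  assumes "\<And>i. i \<le> n \<Longrightarrow> c i \<in> C" "s \<in> G" "a \<in> \<Omega>"
  shows "\<exists>B. finite B \<and> B \<subseteq> \<Omega> \<and> (\<forall>t. agree_on B t s \<longrightarrow> word_path c n t a = word_path c n s a)"
  using assms
proof (induction n)
  case 0
  show ?case by (intro exI[of _ "{}"]) auto
next
  case (Suc n)
  then obtain B where B: "finite B" "B \<subseteq> \<Omega>"
    "\<And>t. agree_on B t s \<Longrightarrow> word_path c n t a = word_path c n s a" by auto
  have w: "word_path c n s a \<in> \<Omega>"
    using Suc.prems by (intro word_path_in) auto
  have "word_path c (Suc n) t a = word_path c (Suc n) s a"
    if "agree_on (insert (word_path c n s a) B) t s" for t
    using B(3)[of t] that by (simp add: agree_on_def)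
  then show ?case
    using B(1,2) w by (intro exI[of _ "insert (word_path c n s a) B"]) simp
qed

text \<open>Each of the \<open>n\<close> occurrences of \<open>z\<close> can be pulled to the front
  through the coefficients, so only their number matters.\<close>

lemma word_path_commute:
  assumes "\<And>i. i \<le> n \<Longrightarrow> c i \<in> C" and a: "a \<in> \<Omega>" and z: "z \<in> G"
    and comm: "\<And>f x. f \<in> C \<Longrightarrow> x \<in> \<Omega> \<Longrightarrow> z (f x) = f (z x)"
  shows "word_path c n z a = (z ^^ n) (word_path c n idm a)"
proof -
  have powers: "(z ^^ k) x \<in> \<Omega> \<and> (z ^^ k) (f x) = f ((z ^^ k) x)"
    if "f \<in> C" "x \<in> \<Omega>" for f x k
    using that by (induction k) (auto simp: comm group_maps z)
  show ?thesis
    using assms(1)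
  proof (induction n)
    case (Suc n)
    have w: "word_path c n idm a \<in> \<Omega>"
      using Suc.prems a id_in_group by (intro word_path_in) auto
    have "word_path c (Suc n) z a = c (Suc n) ((z ^^ Suc n) (word_path c n idm a))"
      using Suc by simp
    also have "\<dots> = (z ^^ Suc n) (c (Suc n) (word_path c n idm a))"
      using powers[of "c (Suc n)" "word_path c n idm a" "Suc n"] w Suc.prems by simp
    also have "\<dots> = (z ^^ Suc n) (word_path c (Suc n) idm a)"
      using w by (simp add: idm_def)
    finally show ?case .
  qed simp
qed

section \<open>Density of inequalities of unequal length\<close>

text \<open>The trajectory of a generic point \<open>a\<close> along both words is built one letter at a time: at each
  step the value of \<open>s\<close> at the current endpoints is still free over the finite set \<open>D\<close> that has been
  decided. The shorter word stops first, after which the longer one moves off its endpoint.\<close>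

lemma dense_inequality_lt:
  assumes mn: "m < n" and l: "\<And>i. i \<le> n \<Longrightarrow> l i \<in> C" and e: "\<And>i. i \<le> m \<Longrightarrow> e i \<in> C"
    and s0: "s0 \<in> G" and B: "finite B" "B \<subseteq> \<Omega>"
  shows "\<exists>s\<in>G. agree_on B s s0 \<and> (\<exists>a\<in>\<Omega>. word_path l n s a \<noteq> word_path e m s a)"
proof -
  \<comment> \<open>Both trajectories have to start outside \<open>acl \<Omega> G B\<close>. As
    \<open>l 0\<close> and \<open>e 0\<close> are injective, this excludes only finitely many
    \<open>a\<close>.\<close>
  have "finite {x \<in> \<Omega>. l 0 x \<in> acl \<Omega> G B}" "finite {x \<in> \<Omega>. e 0 x \<in> acl \<Omega> G B}"
    using l e B by (auto intro!: approximable_preimage_finite acl_finite)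
  then have "infinite (\<Omega> - ({x \<in> \<Omega>. l 0 x \<in> acl \<Omega> G B} \<union> {x \<in> \<Omega>. e 0 x \<in> acl \<Omega> G B}))"
    using infinite_points by (meson Diff_infinite_finite finite_UnI)
  then have "\<Omega> - ({x \<in> \<Omega>. l 0 x \<in> acl \<Omega> G B} \<union> {x \<in> \<Omega>. e 0 x \<in> acl \<Omega> G B}) \<noteq> {}"
    by (metis finite.emptyI)
  then obtain a where a: "a \<in> \<Omega>" "l 0 a \<notin> acl \<Omega> G B" "e 0 a \<notin> acl \<Omega> G B" by auto
  define p where "p i s = word_path l i s a" for i s
  \<comment> \<open>The minimum freezes the shorter trajectory at its final value after
    \<open>m\<close> steps.\<close>
  define q where "q i s = word_path e (min i m) s a" for i s
  \<comment> \<open>The values of \<open>s\<close> on \<open>D\<close> already determine both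
    trajectories up to step \<open>i\<close>, while endpoints still to be moved lie outside
    \<open>acl \<Omega> G D\<close>, where \<open>s\<close> can be changed. The endpoints need to
    differ only once the shorter word has ended.\<close>
  define st where "st i s D \<longleftrightarrow> s \<in> G \<and> finite D \<and> D \<subseteq> \<Omega> \<and> B \<subseteq> D \<and> agree_on B s s0
      \<and> (\<forall>t. agree_on D t s \<longrightarrow> p i t = p i s \<and> q i t = q i s)
      \<and> p i s \<notin> acl \<Omega> G D
      \<and> (i \<le> m \<longrightarrow> q i s \<notin> acl \<Omega> G D)
      \<and> (m < i \<longrightarrow> p i s \<noteq> q i s)" for i s D
  have "\<exists>s D. st i s D" if "i \<le> n" for i
    using that
  proof (induction i)
    case 0
    have "st 0 s0 B"
      using a B s0 by (auto simp: st_def p_def q_def agree_on_def)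
    then show ?case by blast
  next
    case (Suc i)
    then obtain s D where st: "st i s D" by auto
    have sG: "s \<in> G" and D: "finite D" "D \<subseteq> \<Omega>" "B \<subseteq> D" and sB: "agree_on B s s0"
      and det: "\<And>t. agree_on D t s \<Longrightarrow> p i t = p i s \<and> q i t = q i s"
      and pD: "p i s \<notin> acl \<Omega> G D" and qD: "i \<le> m \<Longrightarrow> q i s \<notin> acl \<Omega> G D"
      using st by (auto simp: st_def)
    have pin: "p i s \<in> \<Omega>" and qin: "q i s \<in> \<Omega>"
      using l e Suc.prems sG a by (auto simp: p_def q_def intro!: word_path_in)
    define D' where "D' = insert (p i s) (insert (q i s) D)"
    define F where "F = insert (q i s) (acl \<Omega> G D')"
    have D': "finite D'" "D' \<subseteq> \<Omega>" "D \<subseteq> D'"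
      using D pin qin by (auto simp: D'_def)
    have F: "finite F" using acl_finite D' by (simp add: F_def)
    \<comment> \<open>Once the shorter word has ended, the second point and its coefficient merely
      repeat the first, so that one extension lemma covers both situations.\<close>
    define q' where "q' = (if i < m then q i s else p i s)"
    define g where "g = (if i < m then e (Suc i) else l (Suc i))"
    have q': "q' \<in> \<Omega>" "q' \<notin> acl \<Omega> G D"
      using pin qin pD qD by (auto simp: q'_def)
    have lC: "l (Suc i) \<in> C" and gC: "g \<in> C"
      using l e Suc.prems by (auto simp: g_def)
    obtain s' where s': "s' \<in> G" "agree_on D s' s" "l (Suc i) (s' (p i s)) \<notin> F" "g (s' q') \<notin> F"
      using extend_generically[OF sG D(2) pin pD q' lC gC F] by blast
    have p': "p (Suc i) t = l (Suc i) (s' (p i s))" if "agree_on D' t s'" for t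
    proof -
      have "agree_on D t s" using that s' D' by (auto simp: agree_on_def)
      then have "p i t = p i s" using det by blast
      moreover have "t (p i s) = s' (p i s)" using that by (simp add: agree_on_def D'_def)
      ultimately show ?thesis by (simp add: p_def)
    qed
    have qq: "q (Suc i) t = (if i < m then e (Suc i) (s' (q i s)) else q i s)"
      if "agree_on D' t s'" for t
    proof -
      have "agree_on D t s" using that s' D' by (auto simp: agree_on_def)
      then have *: "q i t = q i s" using det by blast
      show ?thesis
      proof (cases "i < m")
        case True
        have "t (q i s) = s' (q i s)" using that by (simp add: agree_on_def D'_def)
        with * True show ?thesis by (simp add: q_def)
      next
        case False
        with * show ?thesis by (simp add: q_def)
      qed
    qed
    have self: "agree_on D' s' s'" by (simp add: agree_on_def)
    have "st (Suc i) s' D'"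
      unfolding st_def
    proof (intro conjI)
      show "agree_on B s' s0" using sB s' D by (auto simp: agree_on_def)
      show "\<forall>t. agree_on D' t s' \<longrightarrow> p (Suc i) t = p (Suc i) s' \<and> q (Suc i) t = q (Suc i) s'"
        using p' qq self by metis
      show "p (Suc i) s' \<notin> acl \<Omega> G D'"
        using p'[OF self] s' by (simp add: F_def)
      show "Suc i \<le> m \<longrightarrow> q (Suc i) s' \<notin> acl \<Omega> G D'"
        using qq[OF self] s' by (auto simp: F_def q'_def g_def)
      show "m < Suc i \<longrightarrow> p (Suc i) s' \<noteq> q (Suc i) s'"
        using p'[OF self] qq[OF self] s' by (auto simp: F_def)
    qed (use s' D' D in auto)
    then show ?case by blast
  qed
  then obtain s D where "st n s D" by blast
  then show ?thesis
    using mn a by (auto simp: st_def p_def q_def)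
qed

text \<open>An inequality is symmetric in its two sides, so the longer word may be taken as the left
  one.\<close>

lemma dense_inequality:
  assumes "m \<noteq> n" "\<And>i. i \<le> n \<Longrightarrow> l i \<in> C" "\<And>i. i \<le> m \<Longrightarrow> e i \<in> C"
    "s0 \<in> G" "finite B" "B \<subseteq> \<Omega>"
  shows "\<exists>s\<in>G. agree_on B s s0 \<and> (\<exists>a\<in>\<Omega>. word_path l n s a \<noteq> word_path e m s a)"
proof (cases "m < n")
  case True
  then show ?thesis
    by (rule dense_inequality_lt) (use assms in simp_all)
next
  case False
  with assms(1) have "n < m" by simp
  have "\<exists>s\<in>G. agree_on B s s0 \<and> (\<exists>a\<in>\<Omega>. word_path e m s a \<noteq> word_path l n s a)"
    by (rule dense_inequality_lt[OF \<open>n < m\<close>]) (use assms in simp_all)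
  then show ?thesis by (simp add: eq_commute)
qed

section \<open>Non-separation of the identity and a central element\<close>

text \<open>\<open>M\<close> abstracts both monoids of the theorem; products in \<^const>\<open>BijGroup\<close> are
  meaningful only on bijections, so composition is assumed through the evaluation of words.\<close>

lemma not_Hausdorff_zariski:
  fixes M :: "('a \<Rightarrow> 'a, 'b) monoid_scheme"
  assumes GM: "G \<subseteq> carrier M" and MC: "carrier M \<subseteq> C"
    and ext: "\<And>c n s. (\<And>i. i \<le> n \<Longrightarrow> c i \<in> carrier M) \<Longrightarrow> s \<in> G \<Longrightarrow>
        word_eval M c n s \<in> extensional \<Omega>"
    and eval_word: "\<And>c n s a. (\<And>i. i \<le> n \<Longrightarrow> c i \<in> carrier M) \<Longrightarrow> s \<in> G \<Longrightarrow> a \<in> \<Omega> \<Longrightarrow>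
        word_eval M c n s a = word_path c n s a"
    and z: "z \<in> G" "z \<noteq> idm" and central: "\<And>g x. g \<in> G \<Longrightarrow> x \<in> \<Omega> \<Longrightarrow> z (g x) = g (z x)"
  shows "\<not> Hausdorff_space (zariski_topology M)"
proof
  define S where "S = insert (carrier M)
       {{s \<in> carrier M. word_eval M l n s \<noteq> word_eval M e m s} | l n e m.
          (\<forall>i\<le>n. l i \<in> carrier M) \<and> (\<forall>j\<le>m. e j \<in> carrier M)}"
  have neq_iff: "word_eval M l n s \<noteq> word_eval M e m s \<longleftrightarrow>
      (\<exists>a\<in>\<Omega>. word_path l n s a \<noteq> word_path e m s a)"
    if "\<forall>i\<le>n. l i \<in> carrier M" "\<forall>j\<le>m. e j \<in> carrier M" "s \<in> G" for l n e m s
  proof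
    assume "word_eval M l n s \<noteq> word_eval M e m s"
    moreover have "word_eval M l n s \<in> extensional \<Omega>" "word_eval M e m s \<in> extensional \<Omega>"
      using that by (auto intro!: ext)
    ultimately have "\<exists>a\<in>\<Omega>. word_eval M l n s a \<noteq> word_eval M e m s a"
      using extensionalityI by blast
    then show "\<exists>a\<in>\<Omega>. word_path l n s a \<noteq> word_path e m s a"
      using that eval_word by auto
  next
    assume "\<exists>a\<in>\<Omega>. word_path l n s a \<noteq> word_path e m s a"
    then show "word_eval M l n s \<noteq> word_eval M e m s"
      using that eval_word by metis
  qed
  \<comment> \<open>Commuting with \<open>f\<close> at \<open>x\<close> involves only the values of
    \<open>f\<close> at \<open>x\<close> and \<open>z x\<close>, so it passes from \<open>G\<close>
    to its pointwise limits.\<close>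
  have comm: "z (f x) = f (z x)" if f: "f \<in> C" and x: "x \<in> \<Omega>" for f x
  proof -
    have "finite {x, z x} \<and> {x, z x} \<subseteq> \<Omega>" using x z group_maps by simp
    then obtain g where "g \<in> G" "agree_on {x, z x} g f"
      using f unfolding approximable_def by blast
    then show ?thesis using central[of g x] x by (simp add: agree_on_def)
  qed
  \<comment> \<open>On \<open>G\<close> the Zariski topology is coarser than the pointwise one: an
    inequality that holds at \<open>s\<close> is witnessed at one point \<open>a\<close>, where both
    words depend on finitely many values of \<open>s\<close>.\<close>
  have nbhd: "\<exists>B. finite B \<and> B \<subseteq> \<Omega> \<and> (\<forall>t\<in>G. agree_on B t s \<longrightarrow> t \<in> U)"
    if "generate_topology_on S U" "s \<in> U" "s \<in> G" for U s
    using that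
  proof (induction U rule: generate_topology_on.induct)
    case (Int U V)
    then obtain B B' where "finite B" "B \<subseteq> \<Omega>" "\<forall>t\<in>G. agree_on B t s \<longrightarrow> t \<in> U"
      "finite B'" "B' \<subseteq> \<Omega>" "\<forall>t\<in>G. agree_on B' t s \<longrightarrow> t \<in> V" by blast
    then show ?case
      by (intro exI[of _ "B \<union> B'"]) (auto simp: agree_on_def)
  next
    case (UN K)
    then show ?case by (meson Union_iff)
  next
    case (Basis U)
    show ?case
    proof (cases "U = carrier M")
      case True
      then show ?thesis using GM by (intro exI[of _ "{}"]) auto
    next
      case False
      then obtain l n e m where U: "U = {s \<in> carrier M. word_eval M l n s \<noteq> word_eval M e m s}"
        and le: "\<forall>i\<le>n. l i \<in> carrier M" "\<forall>j\<le>m. e j \<in> carrier M"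
        using Basis by (auto simp: S_def)
      obtain a where a: "a \<in> \<Omega>" "word_path l n s a \<noteq> word_path e m s a"
        using neq_iff[OF le Basis(3)] Basis U by auto
      obtain B where B: "finite B" "B \<subseteq> \<Omega>"
        "\<forall>t. agree_on B t s \<longrightarrow> word_path l n t a = word_path l n s a"
        using word_path_finite_support[of n l s a] le MC Basis a by auto
      obtain B' where B': "finite B'" "B' \<subseteq> \<Omega>"
        "\<forall>t. agree_on B' t s \<longrightarrow> word_path e m t a = word_path e m s a"
        using word_path_finite_support[of m e s a] le MC Basis a by auto
      have "t \<in> U" if "t \<in> G" "agree_on (B \<union> B') t s" for t
      proof -
        have "agree_on B t s" "agree_on B' t s" using that by (auto simp: agree_on_def)
        then have "word_path l n t a \<noteq> word_path e m t a" using B B' a by simp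
        then show ?thesis using neq_iff[OF le that(1)] a that GM U by auto
      qed
      then show ?thesis using B B' by (intro exI[of _ "B \<union> B'"]) auto
    qed
  qed auto
  \<comment> \<open>Density is claimed around every \<open>s0\<close> close to \<open>idm\<close>,
    not just at \<open>idm\<close>, because this stronger form is what survives finite
    intersections.\<close>
  have near: "\<exists>B. finite B \<and> B \<subseteq> \<Omega> \<and> (\<forall>s0\<in>G. agree_on B s0 idm \<longrightarrow>
      (\<forall>A. finite A \<longrightarrow> A \<subseteq> \<Omega> \<longrightarrow> (\<exists>s\<in>G. agree_on A s s0 \<and> s \<in> U)))"
    if "generate_topology_on S U" "z \<in> U" for U
    using that
  proof (induction U rule: generate_topology_on.induct)
    case (Int U V)
    then obtain B B' where B: "finite B" "B \<subseteq> \<Omega>" "\<And>s0 A. s0 \<in> G \<Longrightarrow> agree_on B s0 idm \<Longrightarrow>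
        finite A \<Longrightarrow> A \<subseteq> \<Omega> \<Longrightarrow> \<exists>s\<in>G. agree_on A s s0 \<and> s \<in> U"
      and B': "finite B'" "B' \<subseteq> \<Omega>" "\<And>s0 A. s0 \<in> G \<Longrightarrow> agree_on B' s0 idm \<Longrightarrow>
        finite A \<Longrightarrow> A \<subseteq> \<Omega> \<Longrightarrow> \<exists>s\<in>G. agree_on A s s0 \<and> s \<in> V"
      by (metis IntE)
    have "\<exists>s\<in>G. agree_on A s s0 \<and> s \<in> U \<inter> V"
      if s0: "s0 \<in> G" "agree_on (B \<union> B') s0 idm" and A: "finite A" "A \<subseteq> \<Omega>" for s0 A
    proof -
      have s0B: "agree_on B s0 idm" using s0 by (auto simp: agree_on_def)
      \<comment> \<open>Agreement on \<open>B'\<close> keeps \<open>s\<close> close enough to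
        \<open>idm\<close> for density of \<open>V\<close> to apply around \<open>s\<close>. Since
        \<open>U\<close> contains a pointwise neighbourhood of \<open>s\<close> in \<open>G\<close>,
        the next approximation \<open>t\<close> can stay in \<open>U\<close>.\<close>
      obtain s where s: "s \<in> G" "agree_on (A \<union> B') s s0" "s \<in> U"
        using B(3)[OF s0(1) s0B, of "A \<union> B'"] A B' by auto
      obtain E where E: "finite E" "E \<subseteq> \<Omega>" "\<forall>t\<in>G. agree_on E t s \<longrightarrow> t \<in> U"
        using nbhd[OF Int.hyps(1) s(3,1)] by blast
      have sB': "agree_on B' s idm" using s s0 by (auto simp: agree_on_def)
      obtain t where "t \<in> G" "agree_on (A \<union> E) t s" "t \<in> V"
        using B'(3)[OF s(1) sB', of "A \<union> E"] A E by auto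
      then show ?thesis
        using E s by (intro bexI[of _ t]) (auto simp: agree_on_def)
    qed
    then show ?case
      using B(1,2) B'(1,2) by (intro exI[of _ "B \<union> B'"]) (simp; blast)
  next
    case (UN K)
    then obtain U where U: "U \<in> K" "z \<in> U" by blast
    from UN.IH[OF this] obtain B where "finite B" "B \<subseteq> \<Omega>" "\<forall>s0\<in>G. agree_on B s0 idm \<longrightarrow>
      (\<forall>A. finite A \<longrightarrow> A \<subseteq> \<Omega> \<longrightarrow> (\<exists>s\<in>G. agree_on A s s0 \<and> s \<in> U))" by blast
    then show ?case using U by (intro exI[of _ B]) blast
  next
    case (Basis U)
    show ?case
    proof (cases "idm \<in> U")
      case True
      then obtain B where "finite B" "B \<subseteq> \<Omega>" "\<forall>t\<in>G. agree_on B t idm \<longrightarrow> t \<in> U"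
        using nbhd[of U idm] Basis id_in_group generate_topology_on.Basis by blast
      then show ?thesis
        by (intro exI[of _ B]) (auto simp: agree_on_def)
    next
      case False
      then have "U \<noteq> carrier M" using GM id_in_group by blast
      then obtain l n e m where U: "U = {s \<in> carrier M. word_eval M l n s \<noteq> word_eval M e m s}"
        and le: "\<forall>i\<le>n. l i \<in> carrier M" "\<forall>j\<le>m. e j \<in> carrier M"
        using Basis by (auto simp: S_def)
      have leC: "\<And>i. i \<le> n \<Longrightarrow> l i \<in> C" "\<And>i. i \<le> m \<Longrightarrow> e i \<in> C"
        using le MC by auto
      \<comment> \<open>For equal lengths, both sides at \<open>z\<close> arise from those at
        \<open>idm\<close> by the same power of \<open>z\<close>. The sides agree at
        \<open>idm\<close>, which is not in \<open>U\<close>, so they would agree at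
        \<open>z\<close>, which is.\<close>
      have "m \<noteq> n"
      proof
        assume "m = n"
        obtain a where a: "a \<in> \<Omega>" "word_path l n z a \<noteq> word_path e m z a"
          using neq_iff[OF le z(1)] Basis U by auto
        have "word_path l n idm a = word_path e m idm a"
          using neq_iff[OF le id_in_group] False U a GM id_in_group by auto
        then have "word_path l n z a = word_path e m z a"
          using word_path_commute[OF leC(1) a(1) z(1) comm]
            word_path_commute[OF leC(2) a(1) z(1) comm] \<open>m = n\<close> by simp
        with a show False by simp
      qed
      have "\<exists>s\<in>G. agree_on A s s0 \<and> s \<in> U" if "s0 \<in> G" "finite A" "A \<subseteq> \<Omega>" for s0 A
      proof -
        have "\<exists>s\<in>G. agree_on A s s0 \<and> (\<exists>a\<in>\<Omega>. word_path l n s a \<noteq> word_path e m s a)"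
          by (rule dense_inequality[OF \<open>m \<noteq> n\<close>]) (use leC that in simp_all)
        then show ?thesis
          using neq_iff[OF le] U GM by auto
      qed
      \<comment> \<open>With unequal lengths the density holds around every element of
        \<open>G\<close>, so no closeness to \<open>idm\<close> is demanded.\<close>
      then show ?thesis by (intro exI[of _ "{}"]) auto
    qed
  qed auto
  assume H: "Hausdorff_space (zariski_topology M)"
  have openin: "openin (zariski_topology M) U \<longleftrightarrow> generate_topology_on S U" for U
    by (simp add: zariski_topology_def S_def openin_topology_generated_by_iff)
  have "carrier M \<in> S" by (simp add: S_def)
  then have "carrier M \<subseteq> topspace (zariski_topology M)"
    by (simp add: openin openin_subset generate_topology_on.Basis)
  then have "idm \<in> topspace (zariski_topology M)" "z \<in> topspace (zariski_topology M)"
    using GM z id_in_group by auto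
  then obtain U V where UV: "openin (zariski_topology M) U" "openin (zariski_topology M) V"
    "idm \<in> U" "z \<in> V" "disjnt U V"
    using H z(2) unfolding Hausdorff_space_def by metis
  \<comment> \<open>\<open>U\<close> contains all elements of \<open>G\<close> agreeing with
    \<open>idm\<close> on some finite \<open>A\<close>, and density of \<open>V\<close> at
    \<open>idm\<close> puts one of them into \<open>V\<close>.\<close>
  obtain A where A: "finite A" "A \<subseteq> \<Omega>" "\<forall>t\<in>G. agree_on A t idm \<longrightarrow> t \<in> U"
    using nbhd[of U idm] UV openin id_in_group by blast
  have "agree_on B idm idm" for B by (simp add: agree_on_def)
  then obtain s where "s \<in> G" "agree_on A s idm" "s \<in> V"
    using near[of V] UV openin id_in_group A by meson
  with A UV show False by (auto simp: disjnt_iff)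
qed

section \<open>Evaluation of words in the two monoids\<close>

text \<open>Membership in \<open>G\<close> is carried through the induction because the product of
  \<open>BijGroup\<close> is \<open>compose\<close> only when both factors are bijections.\<close>

lemma word_eval_group:
  assumes "\<And>i. i \<le> n \<Longrightarrow> c i \<in> G" "s \<in> G"
  shows "word_eval ((BijGroup \<Omega>)\<lparr>carrier := G\<rparr>) c n s \<in> G
    \<and> (\<forall>a\<in>\<Omega>. word_eval ((BijGroup \<Omega>)\<lparr>carrier := G\<rparr>) c n s a = word_path c n s a)"
  using assms(1)
proof (induction n)
  case 0
  then show ?case by simp
next
  case (Suc n)
  let ?w = "word_eval ((BijGroup \<Omega>)\<lparr>carrier := G\<rparr>) c n s"
  have w: "?w \<in> G" "\<And>a. a \<in> \<Omega> \<Longrightarrow> ?w a = word_path c n s a" using Suc by auto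
  have "word_eval ((BijGroup \<Omega>)\<lparr>carrier := G\<rparr>) c (Suc n) s
      = compose \<Omega> (c (Suc n)) (compose \<Omega> s ?w)"
    using w Suc.prems assms(2) by (simp add: BijGroup_def group_Bij compose_Bij)
  then show ?case
    using w Suc.prems assms(2) by (simp add: compose_in_group compose_eq)
qed

text \<open>The product here is \<open>compose\<close> for arbitrary maps, whose results are
  extensional; for the empty word this property comes from \<open>c 0\<close>.\<close>

lemma word_eval_closure:
  assumes "\<And>i. i \<le> n \<Longrightarrow> c i \<in> \<Omega> \<rightarrow>\<^sub>E \<Omega>"
  shows "word_eval (closure_monoid \<Omega> G) c n s \<in> extensional \<Omega>
    \<and> (\<forall>a\<in>\<Omega>. word_eval (closure_monoid \<Omega> G) c n s a = word_path c n s a)"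
  using assms
proof (induction n)
  case 0
  then show ?case by (auto simp: PiE_def)
next
  case (Suc n)
  then show ?case by (simp add: closure_monoid_def map_monoid_def compose_eq compose_extensional)
qed

end

theorem theorem4p8:
  fixes \<Omega> :: "'a set" and G :: "('a \<Rightarrow> 'a) set"
  assumes "countable \<Omega>" and "infinite \<Omega>"
    and "subgroup G (BijGroup \<Omega>)"
    and "locally_finite_acl \<Omega> G"
    and "centre ((BijGroup \<Omega>)\<lparr>carrier := G\<rparr>) \<noteq> {\<one>\<^bsub>BijGroup \<Omega>\<^esub>}"
  shows "\<not> Hausdorff_space (zariski_topology (closure_monoid \<Omega> G))
    \<and> \<not> Hausdorff_space (zariski_topology ((BijGroup \<Omega>)\<lparr>carrier := G\<rparr>))"
proof -
  interpret lf_acl_perm_group \<Omega> G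
    by (rule lf_acl_perm_group.intro) (use assms in simp_all)
  let ?M = "(BijGroup \<Omega>)\<lparr>carrier := G\<rparr>"
  have one: "\<one>\<^bsub>BijGroup \<Omega>\<^esub> = idm" by (simp add: BijGroup_def idm_def)
  have mult: "g \<otimes>\<^bsub>?M\<^esub> h = compose \<Omega> g h" if "g \<in> G" "h \<in> G" for g h
    using that by (simp add: BijGroup_def group_Bij)
  have "compose \<Omega> idm g = g \<and> compose \<Omega> g idm = g" if "g \<in> G" for g
    using group_PiE[OF that] by (auto simp: PiE_def Id_compose compose_Id idm_def)
  \<comment> \<open>The centre contains \<open>idm\<close>, so differing from the trivial group
    forces a further element \<open>z\<close>.\<close>
  then have "idm \<in> centre ?M"
    using id_in_group mult by (simp add: centre_def)
  then obtain z where zc: "z \<in> centre ?M" and z1: "z \<noteq> idm"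
    using assms(5) one by auto
  have zG: "z \<in> G" using zc by (simp add: centre_def)
  have central: "z (g x) = g (z x)" if "g \<in> G" "x \<in> \<Omega>" for g x
  proof -
    have "compose \<Omega> z g = compose \<Omega> g z"
      using zc that(1) mult zG by (auto simp: centre_def)
    then show ?thesis using that(2) by (metis compose_eq)
  qed
  have GPiE: "G \<subseteq> topspace (pointwise_topology \<Omega>)"
    using group_PiE by (auto simp: pointwise_topology_def)
  have carr: "carrier (closure_monoid \<Omega> G) = pointwise_topology \<Omega> closure_of G"
    by (simp add: closure_monoid_def)
  have PiE: "f \<in> \<Omega> \<rightarrow>\<^sub>E \<Omega>" if "f \<in> carrier (closure_monoid \<Omega> G)" for f
    using subsetD[OF closure_of_subset_approximable that[unfolded carr]]
    by (simp add: approximable_def)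
  have "\<not> Hausdorff_space (zariski_topology (closure_monoid \<Omega> G))"
  proof (rule not_Hausdorff_zariski[OF _ _ _ _ zG z1 central])
    show "G \<subseteq> carrier (closure_monoid \<Omega> G)"
      using closure_of_subset[OF GPiE] carr by simp
    show "carrier (closure_monoid \<Omega> G) \<subseteq> approximable \<Omega> G"
      using closure_of_subset_approximable carr by simp
  qed (simp_all add: word_eval_closure PiE)
  moreover have "\<not> Hausdorff_space (zariski_topology ?M)"
  proof (rule not_Hausdorff_zariski[OF _ _ _ _ zG z1 central])
    show "carrier ?M \<subseteq> approximable \<Omega> G"
      using group_subset_approximable by simp
    show "word_eval ?M c n s \<in> extensional \<Omega>"
      if "\<And>i. i \<le> n \<Longrightarrow> c i \<in> carrier ?M" "s \<in> G" for c n s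
      using word_eval_group[of n c s] that group_PiE by (auto simp: PiE_def)
    show "word_eval ?M c n s a = word_path c n s a"
      if "\<And>i. i \<le> n \<Longrightarrow> c i \<in> carrier ?M" "s \<in> G" "a \<in> \<Omega>" for c n s a
      using word_eval_group[of n c s] that by auto
  qed simp_all
  ultimately show ?thesis by blast
qed

end
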